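(* Let $k\ge3$ and let $\mathscr{T}\in\mathbb{R}^{n_1\times n_2\times n_3\times\cdots\times n_k}$ be a tensor in the HTD format with respect to a dimension tree $\mathcal{T}$ on $D=\{1,2,\dots,k\}$ with $\{1,2\}\in\mathcal{T}$, with leaf factor matrices $\mathbf{U}_t\in\mathbb{R}^{n_t\times r_t}$, $t=1,\dots,k$, and transfer tensors $\mathscr{B}_\tau$ at the internal nodes $\tau\in\mathcal{T}$. Define $\widetilde{\mathbf{U}}_t=\mathbf{F}_{n_t}\mathbf{U}_t\in\mathbb{C}^{n_t\times r_t}$ for $t=3,4,\dots,k$. For a frequency tuple $\boldsymbol{j}=(j_3,\dots,j_k)$, $1\le j_t\le n_t$, let $\mathbf{G}_{\boldsymbol{j}}\in\mathbb{C}^{r_1\times r_2}$ be the reduced matrix obtained by contracting all transfer tensors and the selected leaf rows $\widetilde{\mathbf{U}}_t(j_t,:)$, $t=3,\dots,k$, over the dimension tree, with the rank indices associated with modes $1$ and $2$ left open. Then the Fourier-domain diagonal block of $\mathscr{T}$ corresponding to each frequency tuple $\boldsymbol{j}$ is $$\mathbf{T}_{\boldsymbol{j}}=\mathbf{U}_1\mathbf{G}_{\boldsymbol{j}}\mathbf{U}_2^\top\in\mathbb{C}^{n_1\times n_2}.$$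
   Context: A dimension tree $\mathcal{T}$ on $D=\{1,\dots,k\}$ is a rooted binary tree whose nodes are nonempty subsets of $D$, with root $D$, leaves the singletons $\{t\}$, and each internal node $\tau$ the disjoint union of its two (ordered) children $\tau_1,\tau_2$; the children of $\{1,2\}$ are $\{1\}$ and $\{2\}$. A tensor is in hierarchical Tucker (HTD) format with leaf factors $\mathbf{U}_t\in\mathbb{R}^{n_t\times r_t}$ ($r_{\{t\}}=r_t$) and transfer tensors $\mathscr{B}_\tau\in\mathbb{R}^{r_{\tau_1}\times r_{\tau_2}\times r_\tau}$ ($r_D=1$) if it is recovered by the recursion $\mathbf{U}_\tau(:,\alpha_\tau)=\sum_{\alpha_{\tau_1},\alpha_{\tau_2}}\mathscr{B}_\tau(\alpha_{\tau_1},\alpha_{\tau_2},\alpha_\tau)\,\mathbf{U}_{\tau_1}(:,\alpha_{\tau_1})\otimes\mathbf{U}_{\tau_2}(:,\alpha_{\tau_2})$ from the leaves to the root, i.e. entrywise $$\mathscr{T}(i_1,\dots,i_k)=\sum_{(\alpha_\tau)_{\tau\in\mathcal{T}}}\ \prod_{\tau\text{ internal}}\mathscr{B}_\tau(\alpha_{\tau_1},\alpha_{\tau_2},\alpha_\tau)\ \prod_{t=1}^k\mathbf{U}_t(i_t,\alpha_{\{t\}}),\quad 1\le\alpha_\tau\le r_\tau.$$ Explicitly, the contraction defining $\mathbf{G}_{\boldsymbol{j}}$ is $\mathbf{G}_{\boldsymbol{j}}(\alpha_{\{1\}},\alpha_{\{2\}})=\sum\prod_{\tau\text{ internal}}\mathscr{B}_\tau(\alpha_{\tau_1},\alpha_{\tau_2},\alpha_\tau)\prod_{t=3}^k\widetilde{\mathbf{U}}_t(j_t,\alpha_{\{t\}})$,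 the sum being over all rank indices $\alpha_\tau$, $\tau\in\mathcal{T}\setminus\{\{1\},\{2\}\}$ (with $\alpha_D=1$). $\mathbf{F}_n\in\mathbb{C}^{n\times n}$ is the discrete Fourier transform matrix $\mathbf{F}_n(p,q)=\frac{1}{\sqrt n}\omega^{(p-1)(q-1)}$, $\omega=\exp(-2\pi i/n)$. With mode-$p$ multiplication $(\mathscr{X}\times_p\mathbf{A})(\dots,i,\dots)=\sum_{j_p}\mathbf{A}(i,j_p)\mathscr{X}(\dots,j_p,\dots)$ and $\widetilde{\mathscr{T}}=\mathscr{T}\times_3\mathbf{F}_{n_3}\times_4\cdots\times_k\mathbf{F}_{n_k}$, the Fourier-domain diagonal block at $\boldsymbol{j}$ is $\mathbf{T}_{\boldsymbol{j}}=\widetilde{\mathscr{T}}(:,:,j_3,\dots,j_k)$. *)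

theory Defs
  imports Complex_Main "Jordan_Normal_Form.Matrix"
begin

text \<open>
  Modes are numbered \<open>1, \<dots>, k\<close>; all index values (tensor, rank and frequency indices) are
  0-based, as in the matrix library. A multi-index over a set \<open>\<tau>\<close> of modes is an element of
  \<open>PiE \<tau> (\<lambda>t. {..<n t})\<close>, and a tensor of size \<open>n 1 \<times> \<dots> \<times> n k\<close> is a function on multi-indices,
  of which only the values on \<open>PiE {1..k} (\<lambda>t. {..<n t})\<close> are meaningful.
\<close>

type_synonym 'a tensor = "(nat \<Rightarrow> nat) \<Rightarrow> 'a"

record dim_tree =
  nodes  :: "nat set set"
  lchild :: "nat set \<Rightarrow> nat set"
  rchild :: "nat set \<Rightarrow> nat set"

definition leaf_nodes :: "nat \<Rightarrow> nat set set" where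
  "leaf_nodes k = (\<lambda>t. {t}) ` {1..k}"

definition internal_nodes :: "nat \<Rightarrow> dim_tree \<Rightarrow> nat set set" where
  "internal_nodes k T = nodes T - leaf_nodes k"

text \<open>
  The unique-parent clause makes \<open>nodes T\<close> a tree rooted at \<open>{1..k}\<close>: children are proper
  subsets of their parent, so following parents from any node ends at the root.
\<close>

definition is_dim_tree :: "nat \<Rightarrow> dim_tree \<Rightarrow> bool" where
  "is_dim_tree k T \<longleftrightarrow>
     nodes T \<subseteq> Pow {1..k} - {{}} \<and>
     {1..k} \<in> nodes T \<and>
     leaf_nodes k \<subseteq> nodes T \<and>
     (\<forall>\<tau> \<in> internal_nodes k T.
        lchild T \<tau> \<in> nodes T \<and> rchild T \<tau> \<in> nodes T \<and>
        lchild T \<tau> \<inter> rchild T \<tau> = {} \<and> \<tau> = lchild T \<tau> \<union> rchild T \<tau>) \<and>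
     (\<forall>\<sigma> \<in> nodes T. \<sigma> \<noteq> {1..k} \<longrightarrow>
        (\<exists>!\<tau>. \<tau> \<in> internal_nodes k T \<and> (\<sigma> = lchild T \<tau> \<or> \<sigma> = rchild T \<tau>))) \<and>
     ({1, 2} \<in> nodes T \<longrightarrow> lchild T {1, 2} = {1} \<and> rchild T {1, 2} = {2})"

text \<open>
  \<open>V \<tau> i a\<close> is the entry at multi-index \<open>i\<close> (over the modes in \<open>\<tau>\<close>) of column \<open>a\<close> of the frame
  matrix of node \<open>\<tau>\<close>. Keeping the rows of that matrix indexed by multi-indices, the Kronecker
  product of columns in the recursion is the product of entries at the restricted multi-indices.
  The transfer tensor entry \<open>B \<tau> a b c\<close> has \<open>a\<close>, \<open>b\<close>, \<open>c\<close> as rank indices of the first child, the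
  second child and \<open>\<tau>\<close> itself.
\<close>

definition htd_frames ::
  "nat \<Rightarrow> (nat \<Rightarrow> nat) \<Rightarrow> dim_tree \<Rightarrow> (nat set \<Rightarrow> nat) \<Rightarrow> (nat \<Rightarrow> real mat) \<Rightarrow>
   (nat set \<Rightarrow> nat \<Rightarrow> nat \<Rightarrow> nat \<Rightarrow> real) \<Rightarrow> (nat set \<Rightarrow> (nat \<Rightarrow> nat) \<Rightarrow> nat \<Rightarrow> real) \<Rightarrow> bool" where
  "htd_frames k n T r U B V \<longleftrightarrow>
     (\<forall>t \<in> {1..k}. \<forall>i \<in> PiE {t} (\<lambda>s. {..<n s}). \<forall>a < r {t}. V {t} i a = U t $$ (i t, a)) \<and>
     (\<forall>\<tau> \<in> internal_nodes k T. \<forall>i \<in> PiE \<tau> (\<lambda>s. {..<n s}). \<forall>c < r \<tau>.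
        V \<tau> i c = (\<Sum>a < r (lchild T \<tau>). \<Sum>b < r (rchild T \<tau>).
          B \<tau> a b c * (V (lchild T \<tau>) (restrict i (lchild T \<tau>)) a *
                       V (rchild T \<tau>) (restrict i (rchild T \<tau>)) b)))"

definition in_htd_format ::
  "nat \<Rightarrow> (nat \<Rightarrow> nat) \<Rightarrow> dim_tree \<Rightarrow> (nat set \<Rightarrow> nat) \<Rightarrow> (nat \<Rightarrow> real mat) \<Rightarrow>
   (nat set \<Rightarrow> nat \<Rightarrow> nat \<Rightarrow> nat \<Rightarrow> real) \<Rightarrow> real tensor \<Rightarrow> bool" where
  "in_htd_format k n T r U B X \<longleftrightarrow>
     r {1..k} = 1 \<and>
     (\<forall>t \<in> {1..k}. U t \<in> carrier_mat (n t) (r {t})) \<and>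
     (\<exists>V. htd_frames k n T r U B V \<and>
          (\<forall>i \<in> PiE {1..k} (\<lambda>t. {..<n t}). X i = V {1..k} i 0))"

definition dft_mat :: "nat \<Rightarrow> complex mat" where
  "dft_mat n = mat n n (\<lambda>(p, q).
     complex_of_real (1 / sqrt (real n)) * exp (- 2 * of_real pi * \<i> / of_nat n) ^ (p * q))"

definition mode_mult :: "'a::comm_semiring_1 tensor \<Rightarrow> nat \<Rightarrow> 'a mat \<Rightarrow> 'a tensor" where
  "mode_mult X p A = (\<lambda>i. \<Sum>j < dim_col A. A $$ (i p, j) * X (i(p := j)))"

text \<open>\<open>X \<times>\<^sub>3 F \<times>\<^sub>4 \<dots> \<times>\<^sub>k F\<close>, the mode products being applied in this order.\<close>

definition fourier_tensor :: "nat \<Rightarrow> (nat \<Rightarrow> nat) \<Rightarrow> real tensor \<Rightarrow> complex tensor" where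
  "fourier_tensor k n X =
     fold (\<lambda>t Y. mode_mult Y t (dft_mat (n t))) [3..<Suc k] (\<lambda>i. complex_of_real (X i))"

definition fourier_block ::
  "nat \<Rightarrow> (nat \<Rightarrow> nat) \<Rightarrow> real tensor \<Rightarrow> (nat \<Rightarrow> nat) \<Rightarrow> complex mat" where
  "fourier_block k n X j = mat (n 1) (n 2) (\<lambda>(p, q).
     fourier_tensor k n X (\<lambda>t \<in> {1..k}. if t = 1 then p else if t = 2 then q else j t))"

definition fourier_factor :: "(nat \<Rightarrow> nat) \<Rightarrow> (nat \<Rightarrow> real mat) \<Rightarrow> nat \<Rightarrow> complex mat" where
  "fourier_factor n U t = dft_mat (n t) * map_mat complex_of_real (U t)"

definition reduced_mat ::
  "nat \<Rightarrow> dim_tree \<Rightarrow> (nat set \<Rightarrow> nat) \<Rightarrow> (nat set \<Rightarrow> nat \<Rightarrow> nat \<Rightarrow> nat \<Rightarrow> real) \<Rightarrow>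
   (nat \<Rightarrow> complex mat) \<Rightarrow> (nat \<Rightarrow> nat) \<Rightarrow> complex mat" where
  "reduced_mat k T r B W j = mat (r {1}) (r {2}) (\<lambda>(a, b).
     \<Sum>\<beta> \<in> PiE (nodes T - {{1}, {2}}) (\<lambda>\<tau>. {..<r \<tau>}).
       (let \<alpha> = \<beta>({1} := a, {2} := b) in
         (\<Prod>\<tau> \<in> internal_nodes k T.
            complex_of_real (B \<tau> (\<alpha> (lchild T \<tau>)) (\<alpha> (rchild T \<tau>)) (\<alpha> \<tau>))) *
         (\<Prod>t = 3..k. W t $$ (j t, \<alpha> {t}))))"

end

theory Submission
  imports Defs
begin

text \<open>
  The theorem holds because the entries of a tensor in hierarchical Tucker format are
  multilinear in the rows of the leaf factors, with one factor per mode, so a matrix acting on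
  mode \<open>t\<close> acts on \<open>U t\<close> alone.

  Unrolling the recursion for the frames along the tree gives each entry as a single sum, over
  one rank index for every node, of a product of transfer tensor entries and leaf factor entries
  (lemma \<open>htd_entry\<close>). The mode index \<open>i t\<close> occurs in each summand in the factor
  \<open>U t $$ (i t, \<alpha> {t})\<close> only; hence the mode product with the Fourier matrix can be moved inside
  the sum onto that factor, where it turns \<open>U t\<close> into its Fourier transform
  (\<open>fourier_tensor_htd_entry\<close>). Modes 1 and 2 are left untransformed. Summing first
  over the rank indices of all nodes but \<open>{1}\<close> and \<open>{2}\<close> produces the entry of the
  reduced matrix, and the two remaining sums are the products with \<open>U 1\<close> and with the transpose
  of \<open>U 2\<close>.
\<close>

section \<open>Sums over multi-indices\<close>

lemma sum_PiE_insert: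
  fixes f :: "('a \<Rightarrow> 'b) \<Rightarrow> 'c::comm_monoid_add"
  assumes "x \<notin> A"
  shows "(\<Sum>\<alpha> \<in> PiE (insert x A) S. f \<alpha>) = (\<Sum>c \<in> S x. \<Sum>\<beta> \<in> PiE A S. f (\<beta>(x := c)))"
proof -
  have "(\<Sum>\<alpha> \<in> PiE (insert x A) S. f \<alpha>) = (\<Sum>(c, \<beta>) \<in> S x \<times> PiE A S. f (\<beta>(x := c)))"
    unfolding PiE_insert_eq
    by (subst sum.reindex[OF inj_combinator[OF assms]]) (simp add: o_def case_prod_unfold)
  then show ?thesis by (simp add: sum.cartesian_product)
qed

lemma sum_PiE_Un:
  fixes f :: "('a \<Rightarrow> 'b) \<Rightarrow> 'c::comm_monoid_add"
  assumes "M \<inter> N = {}"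
  shows "(\<Sum>\<alpha> \<in> PiE (M \<union> N) S. f \<alpha>) =
    (\<Sum>\<beta> \<in> PiE M S. \<Sum>\<gamma> \<in> PiE N S. f (\<lambda>x. if x \<in> M then \<beta> x else \<gamma> x))"
proof -
  have "(\<Sum>\<alpha> \<in> PiE (M \<union> N) S. f \<alpha>) =
    (\<Sum>(\<beta>, \<gamma>) \<in> PiE M S \<times> PiE N S. f (\<lambda>x. if x \<in> M then \<beta> x else \<gamma> x))"
  proof (rule sum.reindex_bij_witness[where
        i = "\<lambda>(\<beta>, \<gamma>) x. if x \<in> M then \<beta> x else \<gamma> x" and
        j = "\<lambda>\<alpha>. (restrict \<alpha> M, restrict \<alpha> N)"])
    fix p assume p: "p \<in> PiE M S \<times> PiE N S"
    obtain \<beta> \<gamma> where p': "p = (\<beta>, \<gamma>)" by force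
    show "(\<lambda>\<alpha>. (restrict \<alpha> M, restrict \<alpha> N))
        ((\<lambda>(\<beta>, \<gamma>) x. if x \<in> M then \<beta> x else \<gamma> x) p) = p"
      using p assms by (auto simp: p' fun_eq_iff restrict_def PiE_def extensional_def)
  qed (auto simp: fun_eq_iff PiE_def extensional_def intro!: arg_cong[where f = f])
  then show ?thesis by (simp add: sum.cartesian_product)
qed

section \<open>Subtrees of a dimension tree\<close>

text \<open>
  Generating the subtree below a node downwards from that node, rather than collecting all nodes
  contained in it, makes its decomposition into the subtrees of the two children immediate,
  without a proof that the nodes form a laminar family. The price is \<open>descendants_root\<close>.
\<close>

inductive_set descendants :: "nat \<Rightarrow> dim_tree \<Rightarrow> nat set \<Rightarrow> nat set set"
  for k T \<tau> where
  self: "\<tau> \<in> descendants k T \<tau>"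
| left: "\<sigma> \<in> descendants k T \<tau> \<Longrightarrow> \<sigma> \<in> internal_nodes k T \<Longrightarrow>
    lchild T \<sigma> \<in> descendants k T \<tau>"
| right: "\<sigma> \<in> descendants k T \<tau> \<Longrightarrow> \<sigma> \<in> internal_nodes k T \<Longrightarrow>
    rchild T \<sigma> \<in> descendants k T \<tau>"

lemma descendants_leaf:
  assumes "\<tau> \<notin> internal_nodes k T"
  shows "descendants k T \<tau> = {\<tau>}"
proof -
  have "\<sigma> = \<tau>" if "\<sigma> \<in> descendants k T \<tau>" for \<sigma>
    using that by induction (use assms in auto)
  then show ?thesis by (auto intro: descendants.self)
qed

lemma descendants_internal:
  assumes "\<tau> \<in> internal_nodes k T"
  shows "descendants k T \<tau> =
    insert \<tau> (descendants k T (lchild T \<tau>) \<union> descendants k T (rchild T \<tau>))"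
    (is "_ = ?R")
proof
  show "descendants k T \<tau> \<subseteq> ?R"
  proof
    fix \<sigma> assume "\<sigma> \<in> descendants k T \<tau>"
    then show "\<sigma> \<in> ?R" by induction (auto intro: descendants.intros)
  qed
  have "\<sigma> \<in> descendants k T \<tau>" if "\<sigma> \<in> descendants k T (lchild T \<tau>)" for \<sigma>
    using that by induction (use assms in \<open>auto intro: descendants.intros\<close>)
  moreover have "\<sigma> \<in> descendants k T \<tau>" if "\<sigma> \<in> descendants k T (rchild T \<tau>)" for \<sigma>
    using that by induction (use assms in \<open>auto intro: descendants.intros\<close>)
  ultimately show "?R \<subseteq> descendants k T \<tau>" by (auto intro: descendants.self)
qed

lemma children:
  assumes "is_dim_tree k T" "\<tau> \<in> internal_nodes k T"
  shows "lchild T \<tau> \<in> nodes T" "rchild T \<tau> \<in> nodes T"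
    "lchild T \<tau> \<inter> rchild T \<tau> = {}" "lchild T \<tau> \<union> rchild T \<tau> = \<tau>"
proof -
  have "\<forall>\<tau> \<in> internal_nodes k T.
      lchild T \<tau> \<in> nodes T \<and> rchild T \<tau> \<in> nodes T \<and>
      lchild T \<tau> \<inter> rchild T \<tau> = {} \<and> \<tau> = lchild T \<tau> \<union> rchild T \<tau>"
    using assms(1) unfolding is_dim_tree_def by (elim conjE)
  from bspec[OF this assms(2)] show "lchild T \<tau> \<in> nodes T" "rchild T \<tau> \<in> nodes T"
    "lchild T \<tau> \<inter> rchild T \<tau> = {}" "lchild T \<tau> \<union> rchild T \<tau> = \<tau>" by simp_all
qed

lemma node_nonempty:
  assumes "is_dim_tree k T" "\<tau> \<in> nodes T"
  shows "\<tau> \<noteq> {}" "\<tau> \<subseteq> {1..k}"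
proof -
  have "nodes T \<subseteq> Pow {1..k} - {{}}"
    using assms(1) unfolding is_dim_tree_def by (elim conjE)
  with assms(2) show "\<tau> \<noteq> {}" "\<tau> \<subseteq> {1..k}" by blast+
qed

text \<open>
  Children are nonempty and disjoint, so both are proper subsets of their parent and the
  induction is one on finite sets.
\<close>

lemma dim_tree_induct [consumes 2, case_names leaf internal]:
  assumes T: "is_dim_tree k T" and "\<tau> \<in> nodes T"
    and leaf: "\<And>t. t \<in> {1..k} \<Longrightarrow> P {t}"
    and internal: "\<And>\<tau>. \<tau> \<in> internal_nodes k T \<Longrightarrow> P (lchild T \<tau>) \<Longrightarrow> P (rchild T \<tau>) \<Longrightarrow> P \<tau>"
  shows "P \<tau>"
proof -
  have "finite \<tau>" using node_nonempty(2)[OF assms(1,2)] finite_subset by blast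
  then show ?thesis using assms(2)
  proof (induction \<tau> rule: finite_psubset_induct)
    case (psubset \<tau>)
    show ?case
    proof (cases "\<tau> \<in> internal_nodes k T")
      case True
      note c = children[OF T True]
      have "lchild T \<tau> \<subset> \<tau>" "rchild T \<tau> \<subset> \<tau>"
        using c node_nonempty(1)[OF T c(1)] node_nonempty(1)[OF T c(2)] by blast+
      then show ?thesis using internal[OF True] psubset.IH c by blast
    next
      case False
      then show ?thesis using psubset.prems leaf by (auto simp: internal_nodes_def leaf_nodes_def)
    qed
  qed
qed

lemma descendant_in_nodes:
  assumes "is_dim_tree k T" "\<tau> \<in> nodes T" "\<sigma> \<in> descendants k T \<tau>"
  shows "\<sigma> \<in> nodes T \<and> \<sigma> \<subseteq> \<tau>"
  using assms(3) by induction (use assms(2) children[OF assms(1)] in blast)+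

lemma finite_nodes: "is_dim_tree k T \<Longrightarrow> finite (nodes T)"
  unfolding is_dim_tree_def by (meson finite_Diff finite_Pow_iff finite_atLeastAtMost finite_subset)

lemma leaf_in_descendants:
  assumes "is_dim_tree k T" "\<tau> \<in> nodes T" "t \<in> \<tau>"
  shows "{t} \<in> descendants k T \<tau>"
  using assms
proof (induction rule: dim_tree_induct)
  case (internal \<tau>)
  then show ?case using children(4)[OF assms(1) internal(1)] descendants_internal by blast
qed (auto intro: descendants.self)

text \<open>
  Together with \<open>descendants_internal\<close> this makes a subtree a disjoint union of its root and two
  smaller subtrees, so that products over its nodes and sums over its rank indices factor
  accordingly. A common descendant of both children would be a nonempty subset of two disjoint
  sets.
\<close>

lemma descendants_disjoint:
  assumes "is_dim_tree k T" "\<tau> \<in> internal_nodes k T"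
  shows "descendants k T (lchild T \<tau>) \<inter> descendants k T (rchild T \<tau>) = {}"
    "\<tau> \<notin> descendants k T (lchild T \<tau>)" "\<tau> \<notin> descendants k T (rchild T \<tau>)"
proof -
  note c = children[OF assms]
  note sub = descendant_in_nodes[OF assms(1) c(1)] descendant_in_nodes[OF assms(1) c(2)]
  note nonempty = node_nonempty(1)[OF assms(1)]
  show "descendants k T (lchild T \<tau>) \<inter> descendants k T (rchild T \<tau>) = {}"
    using sub nonempty c(3) by blast
  show "\<tau> \<notin> descendants k T (lchild T \<tau>)"
    using sub(1)[of \<tau>] nonempty[OF c(2)] c(3,4) by blast
  show "\<tau> \<notin> descendants k T (rchild T \<tau>)"
    using sub(2)[of \<tau>] nonempty[OF c(1)] c(3,4) by blast
qed

text \<open>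
  Climbing from any node to its parent strictly increases the cardinality, which is bounded by
  \<open>k\<close>; the climb can only stop at the root.
\<close>

lemma descendants_root:
  assumes T: "is_dim_tree k T"
  shows "descendants k T {1..k} = nodes T"
proof
  have root: "{1..k} \<in> nodes T" using T by (simp add: is_dim_tree_def)
  then show "descendants k T {1..k} \<subseteq> nodes T" using descendant_in_nodes[OF T] by blast
  have "\<sigma> \<in> descendants k T {1..k}" if "\<sigma> \<in> nodes T" for \<sigma>
    using that
  proof (induction "k - card \<sigma>" arbitrary: \<sigma> rule: less_induct)
    case less
    show ?case
    proof (cases "\<sigma> = {1..k}")
      case True
      then show ?thesis by (simp add: descendants.self)
    next
      case False
      then obtain \<pi> where \<pi>: "\<pi> \<in> internal_nodes k T" "\<sigma> = lchild T \<pi> \<or> \<sigma> = rchild T \<pi>"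
        using T less.prems unfolding is_dim_tree_def by meson
      have node: "\<pi> \<in> nodes T" using \<pi>(1) by (simp add: internal_nodes_def)
      have sub: "\<pi> \<subseteq> {1..k}" using node_nonempty(2)[OF T node] .
      have "\<sigma> \<subset> \<pi>"
        using \<pi>(2) children[OF T \<pi>(1)] node_nonempty(1)[OF T] by blast
      then have "card \<sigma> < card \<pi>" using sub finite_subset psubset_card_mono by blast
      moreover have "card \<pi> \<le> k" using card_mono[OF _ sub] by simp
      ultimately have "\<pi> \<in> descendants k T {1..k}" using less.hyps[of \<pi>] node by simp
      then show ?thesis using \<pi> by (auto intro: descendants.intros)
    qed
  qed
  then show "nodes T \<subseteq> descendants k T {1..k}" by blast
qed

section \<open>The entrywise formula\<close>

text \<open>
  The summand of the entrywise formula, for the subtree at \<open>\<tau>\<close> in place of the whole tree.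
\<close>

definition subtree_weight ::
  "nat \<Rightarrow> dim_tree \<Rightarrow> (nat \<Rightarrow> real mat) \<Rightarrow> (nat set \<Rightarrow> nat \<Rightarrow> nat \<Rightarrow> nat \<Rightarrow> real) \<Rightarrow>
   nat set \<Rightarrow> (nat \<Rightarrow> nat) \<Rightarrow> (nat set \<Rightarrow> nat) \<Rightarrow> real" where
  "subtree_weight k T U B \<tau> i \<alpha> =
     (\<Prod>\<sigma> \<in> descendants k T \<tau> \<inter> internal_nodes k T.
        B \<sigma> (\<alpha> (lchild T \<sigma>)) (\<alpha> (rchild T \<sigma>)) (\<alpha> \<sigma>)) *
     (\<Prod>t \<in> \<tau>. U t $$ (i t, \<alpha> {t}))"

lemma subtree_weight_cong:
  assumes "is_dim_tree k T" "\<tau> \<in> nodes T"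
    and "\<And>\<sigma>. \<sigma> \<in> descendants k T \<tau> \<Longrightarrow> \<alpha> \<sigma> = \<beta> \<sigma>"
    and "\<And>t. t \<in> \<tau> \<Longrightarrow> i t = i' t"
  shows "subtree_weight k T U B \<tau> i \<alpha> = subtree_weight k T U B \<tau> i' \<beta>"
  unfolding subtree_weight_def
  by (intro arg_cong2[where f = "(*)"] prod.cong refl)
    (auto simp: assms(3,4) descendants.left descendants.right leaf_in_descendants[OF assms(1,2)])

lemma subtree_weight_internal:
  assumes T: "is_dim_tree k T" and \<tau>: "\<tau> \<in> internal_nodes k T"
  shows "subtree_weight k T U B \<tau> i \<alpha> =
    B \<tau> (\<alpha> (lchild T \<tau>)) (\<alpha> (rchild T \<tau>)) (\<alpha> \<tau>) *
    (subtree_weight k T U B (lchild T \<tau>) i \<alpha> * subtree_weight k T U B (rchild T \<tau>) i \<alpha>)"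
proof -
  note c = children[OF T \<tau>]
  let ?I = "internal_nodes k T" and ?L = "descendants k T (lchild T \<tau>)"
    and ?R = "descendants k T (rchild T \<tau>)"
  let ?b = "\<lambda>\<sigma>. B \<sigma> (\<alpha> (lchild T \<sigma>)) (\<alpha> (rchild T \<sigma>)) (\<alpha> \<sigma>)"
  let ?u = "\<lambda>t. U t $$ (i t, \<alpha> {t})"
  have fin: "finite ?L" "finite ?R"
    using descendant_in_nodes[OF T c(1)] descendant_in_nodes[OF T c(2)] finite_nodes[OF T]
    by (meson finite_subset subsetI)+
  have "descendants k T \<tau> \<inter> ?I = insert \<tau> ((?L \<inter> ?I) \<union> (?R \<inter> ?I))"
    using descendants_internal[OF \<tau>] \<tau> by blast
  moreover have "prod ?b (insert \<tau> ((?L \<inter> ?I) \<union> (?R \<inter> ?I))) =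
      ?b \<tau> * prod ?b ((?L \<inter> ?I) \<union> (?R \<inter> ?I))"
    using descendants_disjoint[OF T \<tau>] fin by (subst prod.insert) auto
  moreover have "prod ?b ((?L \<inter> ?I) \<union> (?R \<inter> ?I)) = prod ?b (?L \<inter> ?I) * prod ?b (?R \<inter> ?I)"
    using descendants_disjoint[OF T \<tau>] fin by (subst prod.union_disjoint) auto
  moreover have "prod ?u \<tau> = prod ?u (lchild T \<tau>) * prod ?u (rchild T \<tau>)"
    using prod.union_disjoint[of "lchild T \<tau>" "rchild T \<tau>" ?u] c
      node_nonempty(2)[OF T c(1)] node_nonempty(2)[OF T c(2)]
    by (simp add: finite_subset)
  ultimately show ?thesis by (simp add: subtree_weight_def algebra_simps)
qed

text \<open>
  The column index of a frame is the rank index of its node, which one level up is summed against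
  a transfer tensor. Stating the expansion for the pairing of the columns with an arbitrary vector
  \<open>h\<close>, instead of for a single column, lets the rank index of \<open>\<tau>\<close> range freely like those of the
  nodes below it, and each induction hypothesis applies with a slice of the transfer tensor in
  the role of \<open>h\<close>.
\<close>

lemma frame_functional_expansion:
  assumes T: "is_dim_tree k T" and V: "htd_frames k n T r U B V" and "\<tau> \<in> nodes T"
    and "i \<in> PiE \<tau> (\<lambda>t. {..<n t})"
  shows "(\<Sum>c < r \<tau>. h c * V \<tau> i c) =
    (\<Sum>\<alpha> \<in> PiE (descendants k T \<tau>) (\<lambda>\<sigma>. {..<r \<sigma>}). h (\<alpha> \<tau>) * subtree_weight k T U B \<tau> i \<alpha>)"
  using assms(1,3,4)
proof (induction arbitrary: i h rule: dim_tree_induct)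
  case (leaf t)
  have ni: "{t} \<notin> internal_nodes k T"
    using leaf by (auto simp: internal_nodes_def leaf_nodes_def)
  have "V {t} i c = U t $$ (i t, c)" if "c < r {t}" for c
    using V leaf that unfolding htd_frames_def by blast
  then show ?case
    using ni by (simp add: descendants_leaf subtree_weight_def sum_PiE_insert)
next
  case (internal \<tau>)
  note c = children[OF T internal(1)]
  let ?l = "lchild T \<tau>" and ?r = "rchild T \<tau>"
  let ?S = "\<lambda>\<sigma>. {..<r \<sigma>}"
  let ?L = "descendants k T ?l" and ?R = "descendants k T ?r"
  let ?w = "subtree_weight k T U B"
  define il ir where "il = restrict i ?l" and "ir = restrict i ?r"
  have il: "il \<in> PiE ?l (\<lambda>t. {..<n t})" and ir: "ir \<in> PiE ?r (\<lambda>t. {..<n t})"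
    using internal.prems c(4) unfolding il_def ir_def by (auto simp: PiE_iff)
  have "(\<Sum>c < r \<tau>. h c * V \<tau> i c) = (\<Sum>c < r \<tau>. h c *
      (\<Sum>a < r ?l. \<Sum>b < r ?r. B \<tau> a b c * (V ?l il a * V ?r ir b)))"
    using V internal(1) internal.prems unfolding htd_frames_def il_def ir_def
    by (intro sum.cong refl) simp
  also have "\<dots> = (\<Sum>c < r \<tau>. \<Sum>a < r ?l.
      (\<Sum>b < r ?r. h c * B \<tau> a b c * V ?r ir b) * V ?l il a)"
    by (simp add: sum_distrib_left sum_distrib_right algebra_simps)
  also have "\<dots> = (\<Sum>c < r \<tau>. \<Sum>\<beta> \<in> PiE ?L ?S.
      (\<Sum>b < r ?r. h c * B \<tau> (\<beta> ?l) b c * V ?r ir b) * ?w ?l il \<beta>)"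
    by (intro sum.cong refl internal.IH(1)[OF il])
  also have "\<dots> = (\<Sum>c < r \<tau>. \<Sum>\<beta> \<in> PiE ?L ?S.
      (\<Sum>\<gamma> \<in> PiE ?R ?S. h c * B \<tau> (\<beta> ?l) (\<gamma> ?r) c * ?w ?r ir \<gamma>) * ?w ?l il \<beta>)"
    by (subst internal.IH(2)[OF ir]) (rule refl)
  \<comment> \<open>The rank indices of the two subtrees and of \<open>\<tau>\<close> are glued into those of the subtree at \<open>\<tau>\<close>.\<close>
  also have "\<dots> = (\<Sum>c < r \<tau>. \<Sum>\<beta> \<in> PiE ?L ?S. \<Sum>\<gamma> \<in> PiE ?R ?S.
      h c * ?w \<tau> i ((\<lambda>\<sigma>. if \<sigma> \<in> ?L then \<beta> \<sigma> else \<gamma> \<sigma>)(\<tau> := c)))"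
  proof (intro sum.cong refl, subst sum_distrib_right, intro sum.cong refl)
    fix c' and \<beta> \<gamma> :: "nat set \<Rightarrow> nat"
    let ?\<alpha> = "(\<lambda>\<sigma>. if \<sigma> \<in> ?L then \<beta> \<sigma> else \<gamma> \<sigma>)(\<tau> := c')"
    note d = descendants_disjoint[OF T internal(1)]
    have \<alpha>l: "?\<alpha> \<sigma> = \<beta> \<sigma>" if "\<sigma> \<in> ?L" for \<sigma> using d that by auto
    have \<alpha>r: "?\<alpha> \<sigma> = \<gamma> \<sigma>" if "\<sigma> \<in> ?R" for \<sigma> using d that by auto
    have "?w ?l i ?\<alpha> = ?w ?l il \<beta>"
      by (rule subtree_weight_cong[OF T c(1) \<alpha>l]) (auto simp: il_def)
    moreover have "?w ?r i ?\<alpha> = ?w ?r ir \<gamma>"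
      by (rule subtree_weight_cong[OF T c(2) \<alpha>r]) (auto simp: ir_def)
    ultimately have "?w \<tau> i ?\<alpha> = B \<tau> (\<beta> ?l) (\<gamma> ?r) c' * (?w ?l il \<beta> * ?w ?r ir \<gamma>)"
      using subtree_weight_internal[OF T internal(1), of U B i ?\<alpha>]
        \<alpha>l[OF descendants.self] \<alpha>r[OF descendants.self] by simp
    then show "h c' * B \<tau> (\<beta> ?l) (\<gamma> ?r) c' * ?w ?r ir \<gamma> * ?w ?l il \<beta> = h c' * ?w \<tau> i ?\<alpha>"
      by simp
  qed
  also have "\<dots> = (\<Sum>\<alpha> \<in> PiE (insert \<tau> (?L \<union> ?R)) ?S. h (\<alpha> \<tau>) * ?w \<tau> i \<alpha>)"
    using descendants_disjoint[OF T internal(1)]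
    by (simp add: sum_PiE_insert sum_PiE_Un)
  finally show ?case by (simp add: descendants_internal[OF internal(1)])
qed

text \<open>
  At the root the rank is 1, so the pairing with the constant vector 1 is the single column of
  the root frame.
\<close>

lemma htd_entry:
  assumes T: "is_dim_tree k T" and X: "in_htd_format k n T r U B X"
    and i: "i \<in> PiE {1..k} (\<lambda>t. {..<n t})"
  shows "X i = (\<Sum>\<alpha> \<in> PiE (nodes T) (\<lambda>\<sigma>. {..<r \<sigma>}).
    (\<Prod>\<sigma> \<in> internal_nodes k T. B \<sigma> (\<alpha> (lchild T \<sigma>)) (\<alpha> (rchild T \<sigma>)) (\<alpha> \<sigma>)) *
    (\<Prod>t \<in> {1..k}. U t $$ (i t, \<alpha> {t})))"
proof -
  obtain V where V: "htd_frames k n T r U B V" and XV: "X i = V {1..k} i 0"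
    and r1: "r {1..k} = 1"
    using X i unfolding in_htd_format_def by blast
  have root: "{1..k} \<in> nodes T" using T by (simp add: is_dim_tree_def)
  have "nodes T \<inter> internal_nodes k T = internal_nodes k T"
    by (auto simp: internal_nodes_def)
  then show ?thesis
    using frame_functional_expansion[OF T V root i, of "\<lambda>_. 1"] r1
    unfolding XV descendants_root[OF T] subtree_weight_def by simp
qed

section \<open>Mode products act on one factor at a time\<close>

text \<open>
  Each summand is a product of functions of one mode index each (a rank-one term, for fixed
  \<open>\<alpha>\<close>). The representation is assumed on the index box only, since a tensor is arbitrary outside
  of it; the box is left invariant because \<open>A\<close> has \<open>n p\<close> columns.
\<close>

lemma mode_mult_multilinear:
  fixes Y :: "complex tensor"
  assumes "finite K" "p \<in> K" "i \<in> PiE K (\<lambda>t. {..<n t})" "dim_col A = n p"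
    and Y: "\<And>i. i \<in> PiE K (\<lambda>t. {..<n t}) \<Longrightarrow> Y i = (\<Sum>\<alpha> \<in> S. g \<alpha> * (\<Prod>t \<in> K. w t (i t) \<alpha>))"
  shows "mode_mult Y p A i = (\<Sum>\<alpha> \<in> S. g \<alpha> *
    (\<Prod>t \<in> K. (w(p := \<lambda>m \<alpha>. \<Sum>l < n p. A $$ (m, l) * w p l \<alpha>)) t (i t) \<alpha>))"
proof -
  have upd: "i(p := l) \<in> PiE K (\<lambda>t. {..<n t})" if "l < n p" for l
    using assms(2,3) that by (auto simp: PiE_iff extensional_def)
  have split: "(\<Prod>t \<in> K. f t) = f p * (\<Prod>t \<in> K - {p}. f t)" for f :: "nat \<Rightarrow> complex"
    using assms(1,2) by (rule prod.remove)
  have "mode_mult Y p A i = (\<Sum>l < n p. A $$ (i p, l) *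
      (\<Sum>\<alpha> \<in> S. g \<alpha> * (w p l \<alpha> * (\<Prod>t \<in> K - {p}. w t (i t) \<alpha>))))"
    unfolding mode_mult_def assms(4)
    by (intro sum.cong refl) (simp add: Y[OF upd] split)
  also have "\<dots> = (\<Sum>\<alpha> \<in> S. g \<alpha> * ((\<Sum>l < n p. A $$ (i p, l) * w p l \<alpha>) *
      (\<Prod>t \<in> K - {p}. w t (i t) \<alpha>)))"
    unfolding sum_distrib_left sum_distrib_right
    by (subst sum.swap) (simp add: algebra_simps)
  finally show ?thesis by (simp add: split)
qed

text \<open>
  The modes in \<open>ps\<close> must be distinct: for a repeated mode the left-hand side would apply its matrix
  twice, the right-hand side once.
\<close>

lemma fold_mode_mult_multilinear:
  fixes Y :: "complex tensor"
  assumes "finite K" "set ps \<subseteq> K" "distinct ps" "i \<in> PiE K (\<lambda>t. {..<n t})"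
    and "\<And>t. dim_col (A t) = n t"
    and "\<And>i. i \<in> PiE K (\<lambda>t. {..<n t}) \<Longrightarrow> Y i = (\<Sum>\<alpha> \<in> S. g \<alpha> * (\<Prod>t \<in> K. w t (i t) \<alpha>))"
  shows "fold (\<lambda>t Y. mode_mult Y t (A t)) ps Y i = (\<Sum>\<alpha> \<in> S. g \<alpha> *
    (\<Prod>t \<in> K. if t \<in> set ps then \<Sum>l < n t. A t $$ (i t, l) * w t l \<alpha> else w t (i t) \<alpha>))"
  using assms(2,3,6)
proof (induction ps arbitrary: Y w)
  case Nil
  then show ?case using assms(4) by simp
next
  case (Cons p ps)
  let ?w = "w(p := \<lambda>m \<alpha>. \<Sum>l < n p. A p $$ (m, l) * w p l \<alpha>)"
  have "mode_mult Y p (A p) i = (\<Sum>\<alpha> \<in> S. g \<alpha> * (\<Prod>t \<in> K. ?w t (i t) \<alpha>))"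
    if "i \<in> PiE K (\<lambda>t. {..<n t})" for i
    using Cons.prems by (intro mode_mult_multilinear assms(1,5) that) auto
  then have "fold (\<lambda>t Y. mode_mult Y t (A t)) ps (mode_mult Y p (A p)) i = (\<Sum>\<alpha> \<in> S. g \<alpha> *
    (\<Prod>t \<in> K. if t \<in> set ps then \<Sum>l < n t. A t $$ (i t, l) * ?w t l \<alpha> else ?w t (i t) \<alpha>))"
    using Cons.prems by (intro Cons.IH) auto
  also have "\<dots> = (\<Sum>\<alpha> \<in> S. g \<alpha> * (\<Prod>t \<in> K. if t \<in> set (p # ps)
      then \<Sum>l < n t. A t $$ (i t, l) * w t l \<alpha> else w t (i t) \<alpha>))"
    using Cons.prems(2) by (intro sum.cong prod.cong refl arg_cong2[where f = "(*)"]) auto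
  finally show ?case by simp
qed

lemma fourier_tensor_htd_entry:
  assumes k: "k \<ge> 3" and T: "is_dim_tree k T" and X: "in_htd_format k n T r U B X"
    and m: "m \<in> PiE {1..k} (\<lambda>t. {..<n t})"
  shows "fourier_tensor k n X m = (\<Sum>\<alpha> \<in> PiE (nodes T) (\<lambda>\<sigma>. {..<r \<sigma>}).
    (\<Prod>\<sigma> \<in> internal_nodes k T.
      complex_of_real (B \<sigma> (\<alpha> (lchild T \<sigma>)) (\<alpha> (rchild T \<sigma>)) (\<alpha> \<sigma>))) *
    (complex_of_real (U 1 $$ (m 1, \<alpha> {1})) * complex_of_real (U 2 $$ (m 2, \<alpha> {2})) *
     (\<Prod>t = 3..k. fourier_factor n U t $$ (m t, \<alpha> {t}))))"
    (is "_ = (\<Sum>\<alpha> \<in> ?A. ?g \<alpha> * ?f \<alpha>)")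
proof -
  let ?u = "\<lambda>t l \<alpha>. complex_of_real (U t $$ (l, \<alpha> {t}))"
  have "fourier_tensor k n X m = (\<Sum>\<alpha> \<in> ?A. ?g \<alpha> * (\<Prod>t \<in> {1..k}. if t \<in> set [3..<Suc k]
      then \<Sum>l < n t. dft_mat (n t) $$ (m t, l) * ?u t l \<alpha> else ?u t (m t) \<alpha>))"
    unfolding fourier_tensor_def using m
    by (intro fold_mode_mult_multilinear) (auto simp: dft_mat_def htd_entry[OF T X])
  also have "\<dots> = (\<Sum>\<alpha> \<in> ?A. ?g \<alpha> * ?f \<alpha>)"
  proof (intro sum.cong refl arg_cong2[where f = "(*)"])
    fix \<alpha> assume \<alpha>: "\<alpha> \<in> ?A"
    have D: "{1..k} = insert 1 (insert 2 {3..k})" using k by auto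
    have "(\<Sum>l < n t. dft_mat (n t) $$ (m t, l) * ?u t l \<alpha>) = fourier_factor n U t $$ (m t, \<alpha> {t})"
      if t: "t \<in> {3..k}" for t
    proof -
      have t1: "t \<in> {1..k}" using t by auto
      then have U: "U t \<in> carrier_mat (n t) (r {t})"
        using X unfolding in_htd_format_def by blast
      have "m t < n t" using m t1 by (auto simp: PiE_iff)
      moreover have "{t} \<in> nodes T" using T t1 by (auto simp: is_dim_tree_def leaf_nodes_def)
      then have "\<alpha> {t} < r {t}" using \<alpha> by (auto simp: PiE_iff)
      ultimately show ?thesis using U
        by (auto simp: fourier_factor_def dft_mat_def scalar_prod_def lessThan_atLeast0
            intro!: sum.cong)
    qed
    then have "(\<Prod>t \<in> {3..k}. if t \<in> set [3..<Suc k]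
        then \<Sum>l < n t. dft_mat (n t) $$ (m t, l) * ?u t l \<alpha> else ?u t (m t) \<alpha>) =
      (\<Prod>t \<in> {3..k}. fourier_factor n U t $$ (m t, \<alpha> {t}))"
      by (intro prod.cong) auto
    then show "(\<Prod>t \<in> {1..k}. if t \<in> set [3..<Suc k]
        then \<Sum>l < n t. dft_mat (n t) $$ (m t, l) * ?u t l \<alpha> else ?u t (m t) \<alpha>) = ?f \<alpha>"
      unfolding D by (simp del: set_upt) simp
  qed
  finally show ?thesis .
qed

section \<open>The Fourier-domain blocks\<close>

theorem proposition4p2:
  fixes k :: nat
    and n :: "nat \<Rightarrow> nat"
    and T :: dim_tree
    and r :: "nat set \<Rightarrow> nat"
    and U :: "nat \<Rightarrow> real mat"
    and B :: "nat set \<Rightarrow> nat \<Rightarrow> nat \<Rightarrow> nat \<Rightarrow> real"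
    and X :: "real tensor"
    and j :: "nat \<Rightarrow> nat"
  assumes "k \<ge> 3"
    and "is_dim_tree k T"
    and "{1, 2} \<in> nodes T"
    and "in_htd_format k n T r U B X"
    and "j \<in> PiE {3..k} (\<lambda>t. {..<n t})"
  defines "G \<equiv> reduced_mat k T r B (fourier_factor n U) j"
  shows "G \<in> carrier_mat (r {1}) (r {2}) \<and>
    fourier_block k n X j \<in> carrier_mat (n 1) (n 2) \<and>
    fourier_block k n X j =
      map_mat complex_of_real (U 1) * G * transpose_mat (map_mat complex_of_real (U 2))"
proof (intro conjI)
  let ?N = "nodes T - {{1}, {2}}" and ?S = "\<lambda>\<sigma>. {..<r \<sigma>}"
  let ?U = "\<lambda>t. map_mat complex_of_real (U t)"
  show G: "G \<in> carrier_mat (r {1}) (r {2})" by (simp add: G_def reduced_mat_def)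
  show "fourier_block k n X j \<in> carrier_mat (n 1) (n 2)" by (simp add: fourier_block_def)
  have U: "U 1 \<in> carrier_mat (n 1) (r {1})" "U 2 \<in> carrier_mat (n 2) (r {2})"
    using assms(1,4) unfolding in_htd_format_def by auto
  have nodes: "nodes T = insert {2} (insert {1} ?N)"
    using assms(1,2) by (auto simp: is_dim_tree_def leaf_nodes_def)
  define weight where "weight = (\<lambda>\<alpha>. (\<Prod>\<sigma> \<in> internal_nodes k T.
      complex_of_real (B \<sigma> (\<alpha> (lchild T \<sigma>)) (\<alpha> (rchild T \<sigma>)) (\<alpha> \<sigma>))) *
    (\<Prod>t = 3..k. fourier_factor n U t $$ (j t, \<alpha> {t})))"
  have Gab: "G $$ (a, b) = (\<Sum>\<beta> \<in> PiE ?N ?S. weight (\<beta>({1} := a, {2} := b)))"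
    if "a < r {1}" "b < r {2}" for a b
    using that by (simp add: G_def reduced_mat_def weight_def Let_def)
  show "fourier_block k n X j = ?U 1 * G * transpose_mat (?U 2)"
  proof (rule eq_matI)
    fix p q assume "p < dim_row (?U 1 * G * transpose_mat (?U 2))"
      "q < dim_col (?U 1 * G * transpose_mat (?U 2))"
    then have p: "p < n 1" and q: "q < n 2" using U by auto
    let ?m = "\<lambda>t \<in> {1..k}. if t = 1 then p else if t = 2 then q else j t"
    let ?a = "\<lambda>a. complex_of_real (U 1 $$ (p, a))" and ?b = "\<lambda>b. complex_of_real (U 2 $$ (q, b))"
    have m: "?m \<in> PiE {1..k} (\<lambda>t. {..<n t})"
      using p q assms(5) by (auto simp: PiE_iff)
    have m12: "?m 1 = p" "?m 2 = q" using assms(1) by auto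
    have m3: "(\<Prod>t = 3..k. fourier_factor n U t $$ (?m t, \<alpha> {t})) =
        (\<Prod>t = 3..k. fourier_factor n U t $$ (j t, \<alpha> {t}))" for \<alpha>
      by (intro prod.cong) auto
    have "fourier_block k n X j $$ (p, q) = fourier_tensor k n X ?m"
      using p q by (simp add: fourier_block_def)
    also have "\<dots> = (\<Sum>\<alpha> \<in> PiE (nodes T) ?S. ?a (\<alpha> {1}) * ?b (\<alpha> {2}) * weight \<alpha>)"
      unfolding fourier_tensor_htd_entry[OF assms(1,2,4) m] m12 m3 weight_def
      by (simp add: mult_ac)
    \<comment> \<open>Node \<open>{2}\<close> is split off first, so that the two updates come in the order used in the
      definition of the reduced matrix.\<close>
    also have "\<dots> = (\<Sum>b < r {2}. \<Sum>a < r {1}. \<Sum>\<beta> \<in> PiE ?N ?S.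
        ?a a * ?b b * weight (\<beta>({1} := a, {2} := b)))"
      by (subst nodes) (simp add: sum_PiE_insert)
    also have "\<dots> = (\<Sum>b < r {2}. \<Sum>a < r {1}. ?a a * G $$ (a, b) * ?b b)"
      by (intro sum.cong refl) (simp add: Gab sum_distrib_left sum_distrib_right mult_ac)
    also have "\<dots> = (\<Sum>a < r {1}. ?a a * (\<Sum>b < r {2}. G $$ (a, b) * ?b b))"
      unfolding sum_distrib_left by (subst sum.swap) (simp add: mult_ac)
    also have "\<dots> = (?U 1 * G * transpose_mat (?U 2)) $$ (p, q)"
      using p q U G
      by (auto simp: scalar_prod_def lessThan_atLeast0 sum_distrib_right intro!: sum.cong)
    finally show "fourier_block k n X j $$ (p, q) = (?U 1 * G * transpose_mat (?U 2)) $$ (p, q)" .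
  qed (use U in \<open>auto simp: fourier_block_def\<close>)
qed

end
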